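(* Let $r,m,r'$ be integers with $m\ge 1$ and $1\le r'\le r-1$, and put $n=rm+r'$, $k=n-r$, $l=r^{m+1}$. Let $F$ be a finite field with $|F|\ge r(m+1)$, let $\lambda_1,\dots,\lambda_{r(m+1)}$ be distinct elements of $F$, and let $\gamma\in F\setminus\{0,1\}$. Let $$\mathcal C'=\Big\{(C_1,\dots,C_n)\in (F^l)^n:\ \sum_{i=1}^n A_{t,i}C_i=0,\ t=0,1,\dots,r-1\Big\},$$ where the $l\times l$ matrices $A_{t,i}$, $0\le t\le r-1$, $1\le i\le n$, are those defined in the context. Then $\mathcal C'$ is an $(n=rm+r',\ k=n-r,\ l=r^{m+1})$ MDS array code.
   Context: Conventions: $[n]=\{1,\dots,n\}$; $0^0=1$. Rows and columns of an $l\times l$ matrix $A$ are indexed by $0,1,\dots,l-1$, and $A(a,b)$ denotes the entry in row $a$, column $b$. An $(n,k,l)$ array code over $F$ (length $n$, dimension $k$, sub-packetization $l$) is an $F$-linear subspace $\mathcal C\subseteq(F^l)^n$ with $\dim_F\mathcal C=kl$; codewords are written $(C_1,\dots,C_n)$ with $C_i\in F^l$. It is MDS if any $k$ of the $n$ columns $C_i$ of a codeword suffice to recover the remaining $n-k$ columns. The matrices $A_{t,i}$. For an integer $a$ with $0\le a\le l-1$, write its $r$-ary expansion as $a=(a_{m+1},a_m,\dots,a_1)$, i.e. $a=\sum_{v=1}^{m+1} a_v r^{v-1}$ with $0\le a_v\le r-1$. For $v\in\{1,\dots,m+1\}$ and $0\le u\le r-1$ let $a(v,u)$ be the integer obtained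 from $a$ by replacing the digit $a_v$ by $u$ and keeping all other digits. Each $i\in[n]$ is written uniquely as $i=(v-1)r+u+1$ where either $v\in[m]$ and $u\in\{0,\dots,r-1\}$, or $v=m+1$ and $u\in\{0,\dots,r'-1\}$. For all such $(v,u)$, all $t=0,\dots,r-1$ and $0\le a,b\le l-1$, $$A_{t,(v-1)r+u+1}(a,b)=\begin{cases}\lambda_{(v-1)r+u+1}^t & \text{if } a_v<u,\ b=a,\\ \gamma\lambda_{(v-1)r+u+1}^t & \text{if } a_v>u,\ b=a,\\ \lambda_{(v-1)r+w+1}^t & \text{if } a_v=u,\ b=a(v,w)\text{ for some } w\in\{0,1,\dots,r-1\},\\ 0&\text{otherwise.}\end{cases}$$ *)

theory Defs
  imports "Jordan_Normal_Form.VS_Connect"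
begin

text \<open>
  An element \<open>(C\<^sub>1, \<dots>, C\<^sub>n)\<close> of \<open>(F\<^sup>l)\<^sup>n\<close> is the \<open>l \<times> n\<close> matrix whose columns are the \<open>C\<^sub>i\<close>.
  Matrix columns are numbered from 0 and the \<open>C\<^sub>i\<close> from 1.
\<close>

definition node :: "'a mat \<Rightarrow> nat \<Rightarrow> 'a vec" where
  "node C i = col C (i - 1)"

definition array_code :: "nat \<Rightarrow> nat \<Rightarrow> nat \<Rightarrow> 'a::field mat set \<Rightarrow> bool" where
  "array_code n k l \<C> \<longleftrightarrow>
     subspace class_ring \<C> (module_mat TYPE('a) l n) \<and>
     vectorspace.dim class_ring ((module_mat TYPE('a) l n)\<lparr>carrier := \<C>\<rparr>) = k * l"

definition mds_array_code :: "nat \<Rightarrow> nat \<Rightarrow> nat \<Rightarrow> 'a::field mat set \<Rightarrow> bool" where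
  "mds_array_code n k l \<C> \<longleftrightarrow>
     array_code n k l \<C> \<and>
     (\<forall>S \<subseteq> {1..n}. card S = k \<longrightarrow>
        (\<forall>C \<in> \<C>. \<forall>D \<in> \<C>. (\<forall>i \<in> S. node C i = node D i) \<longrightarrow>
           (\<forall>i \<in> {1..n} - S. node C i = node D i)))"

text \<open>Digit positions \<open>v\<close> are numbered from 1, least significant first.\<close>

definition digit :: "nat \<Rightarrow> nat \<Rightarrow> nat \<Rightarrow> nat" where
  "digit r a v = a div r ^ (v - 1) mod r"

definition set_digit :: "nat \<Rightarrow> nat \<Rightarrow> nat \<Rightarrow> nat \<Rightarrow> nat" where
  "set_digit r a v u = a - digit r a v * r ^ (v - 1) + u * r ^ (v - 1)"

text \<open>
  For \<open>1 \<le> i\<close>, the \<open>v\<close> and \<open>u\<close> below are the unique numbers with \<open>i = (v - 1) * r + u + 1\<close>,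
  \<open>1 \<le> v\<close> and \<open>u < r\<close>. In the third case \<open>b = a(v,w)\<close>, so \<open>w\<close> is the \<open>v\<close>-th digit of \<open>b\<close>.
\<close>

definition parity_block ::
  "nat \<Rightarrow> nat \<Rightarrow> (nat \<Rightarrow> 'a::field) \<Rightarrow> 'a \<Rightarrow> nat \<Rightarrow> nat \<Rightarrow> 'a mat" where
  "parity_block r m lam \<gamma> t i =
     (let v = (i - 1) div r + 1; u = (i - 1) mod r in
      mat (r ^ (m + 1)) (r ^ (m + 1)) (\<lambda>(a, b).
        if digit r a v < u \<and> b = a then lam ((v - 1) * r + u + 1) ^ t
        else if digit r a v > u \<and> b = a then \<gamma> * lam ((v - 1) * r + u + 1) ^ t
        else if digit r a v = u \<and> (\<exists>w < r. b = set_digit r a v w)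
          then lam ((v - 1) * r + digit r b v + 1) ^ t
        else 0))"

definition parity_code ::
  "nat \<Rightarrow> nat \<Rightarrow> nat \<Rightarrow> (nat \<Rightarrow> 'a::field) \<Rightarrow> 'a \<Rightarrow> 'a mat set" where
  "parity_code r m n lam \<gamma> =
     {C \<in> carrier_mat (r ^ (m + 1)) n. \<forall>t < r.
        finsum_vec TYPE('a) (r ^ (m + 1))
          (\<lambda>i. parity_block r m lam \<gamma> t i *\<^sub>v node C i) {1..n} = 0\<^sub>v (r ^ (m + 1))}"

end

theory Submission
  imports Defs
begin

text \<open>
  Everything follows from one claim: a codeword supported on a set \<open>T\<close> of at most \<open>r\<close> nodes is zero.
  Row \<open>a\<close> of the parity checks is a Vandermonde system in the \<open>\<lambda>\<close>'s, where the unknown attached to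
  node \<open>(v,w)\<close> combines coordinate \<open>a\<close> of that node with coordinate \<open>a(v,w)\<close> of node \<open>(v,a\<^sub>v)\<close>.
  Induct on the number of \<open>v\<close> with \<open>(v,a\<^sub>v) \<in> T\<close>. Replacing such a digit \<open>a\<^sub>v\<close> by some \<open>w\<close> with
  \<open>(v,w) \<notin> T\<close> lowers this number, so all unknowns outside \<open>T\<close> vanish, and then the at most \<open>r\<close>
  remaining ones do. Two nodes \<open>(v,a\<^sub>v), (v,w) \<in> T\<close> are separated by comparing rows \<open>a\<close> and
  \<open>a(v,w)\<close>: the resulting \<open>2 \<times> 2\<close> system has determinant \<open>\<gamma> - 1\<close>.

  The claim gives the recovery property, and also that the parity check map restricted to words
  supported on \<open>r\<close> nodes is an injective, hence bijective, map between sets of the same finite size.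
  So that map is surjective, and rank-nullity gives the dimension.
\<close>

section \<open>Base-\<open>r\<close> digits of row indices\<close>

lemma digit_less: "0 < r \<Longrightarrow> digit r a v < r"
  by (simp add: digit_def)

lemma set_digit_digit: "set_digit r a v (digit r a v) = a"
proof -
  have "digit r a v * r ^ (v - 1) \<le> a"
    unfolding digit_def
    by (meson div_times_less_eq_dividend le_trans mod_less_eq_dividend mult_le_mono1)
  then show ?thesis by (simp add: set_digit_def)
qed

text \<open>Splits \<open>a\<close> into its high digits, the digit of weight \<open>r ^ v\<close>
  and the residue below it. This removes the truncated subtraction in \<open>set_digit\<close>, so
  quotients and residues can be read off.\<close>

lemma set_digit_expand:
  "set_digit r a (Suc v) w = a div r ^ Suc v * r ^ Suc v + w * r ^ v + a mod r ^ v"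
proof -
  have "a div r ^ v = a div r ^ Suc v * r + a div r ^ v mod r"
    by (metis div_mult2_eq div_mult_mod_eq mult.commute power_Suc)
  then have "a = (a div r ^ Suc v * r + a div r ^ v mod r) * r ^ v + a mod r ^ v"
    by (metis div_mult_mod_eq)
  then have "a = a div r ^ Suc v * r ^ Suc v + (a div r ^ v mod r) * r ^ v + a mod r ^ v"
    by (simp only: power_Suc add_mult_distrib mult.assoc)
  then have "a - (a div r ^ v mod r) * r ^ v = a div r ^ Suc v * r ^ Suc v + a mod r ^ v"
    by linarith
  then show ?thesis by (simp add: set_digit_def digit_def)
qed

lemma set_digit_div:
  assumes "w < r"
  shows "set_digit r a (Suc v) w div r ^ Suc v = a div r ^ Suc v"
proof -
  \<comment> \<open>The new digit and the low part together stay below \<open>r ^ Suc v\<close>, so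
    no carry reaches the higher digits.\<close>
  have "w * r ^ v + a mod r ^ v < Suc w * r ^ v" using assms by simp
  also have "\<dots> \<le> r ^ Suc v" using assms by (simp only: power_Suc) (rule mult_le_mono1, simp)
  finally have less: "w * r ^ v + a mod r ^ v < r ^ Suc v" .
  have "set_digit r a (Suc v) w = a div r ^ Suc v * r ^ Suc v + (w * r ^ v + a mod r ^ v)"
    by (simp only: set_digit_expand add.assoc)
  also have "\<dots> div r ^ Suc v = a div r ^ Suc v"
    using less by (metis add.right_neutral add.commute div_less div_mult_self1 less_zeroE)
  finally show ?thesis .
qed

lemma set_digit_mod: "set_digit r a (Suc v) w mod r ^ v = a mod r ^ v"
proof -
  have "set_digit r a (Suc v) w = (a div r ^ Suc v * r + w) * r ^ v + a mod r ^ v"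
    by (simp add: set_digit_expand algebra_simps)
  then show ?thesis by simp
qed

lemma digit_set_digit_same:
  assumes "w < r" shows "digit r (set_digit r a (Suc v) w) (Suc v) = w"
proof -
  have "set_digit r a (Suc v) w = (a div r ^ Suc v * r + w) * r ^ v + a mod r ^ v"
    by (simp add: set_digit_expand algebra_simps)
  then have "set_digit r a (Suc v) w div r ^ v = a div r ^ Suc v * r + w"
    using assms by simp
  then show ?thesis using assms by (simp add: digit_def)
qed

lemma set_digit_set_digit:
  "w < r \<Longrightarrow> set_digit r (set_digit r a (Suc v) w) (Suc v) u = set_digit r a (Suc v) u"
  by (simp only: set_digit_expand[of r _ v u] set_digit_div set_digit_mod)

text \<open>Lower digits depend only on the residue modulo \<open>r ^ v\<close>, higher ones only on
  the quotient by \<open>r ^ Suc v\<close>; the replacement preserves both.\<close>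

lemma digit_set_digit_other:
  assumes "w < r" "v \<noteq> v'"
  shows "digit r (set_digit r a (Suc v) w) (Suc v') = digit r a (Suc v')"
proof (cases "v' < v")
  case True
  then obtain e where v: "v = Suc (v' + e)" using less_imp_Suc_add by blast
  have "b div r ^ v' mod r = b mod r ^ v div r ^ v' mod r" for b
  proof -
    have "b = (b div r ^ v * r ^ e * r) * r ^ v' + b mod r ^ v"
      using div_mult_mod_eq[of b "r ^ v"] by (simp only: v power_Suc power_add mult_ac)
    then have "b div r ^ v' = b div r ^ v * r ^ e * r + b mod r ^ v div r ^ v'"
      using assms by (metis add.commute div_mult_self1 gr_implies_not0 power_not_zero)
    then show ?thesis by simp
  qed
  then show ?thesis by (metis digit_def diff_Suc_1 set_digit_mod)
next
  case False
  then obtain e where v': "v' = Suc v + e" using assms by (metis add.commute le_iff_add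
    linorder_neqE_nat Suc_leI)
  have "b div r ^ v' = b div r ^ Suc v div r ^ e" for b
    unfolding v' power_add by (rule div_mult2_eq)
  then show ?thesis
    unfolding digit_def diff_Suc_1 by (simp only: set_digit_div[OF assms(1)])
qed

lemma set_digit_less:
  assumes "a < r ^ Suc m" "w < r" "v \<le> m"
  shows "set_digit r a (Suc v) w < r ^ Suc m"
proof -
  obtain e where m: "m = v + e" using assms by (metis le_iff_add)
  have "a div r ^ Suc v < r ^ e"
  proof (rule less_mult_imp_div_less)
    show "a < r ^ e * r ^ Suc v" using assms(1) by (simp add: m power_add mult_ac)
  qed
  have "w * r ^ v + a mod r ^ v < Suc w * r ^ v" using assms by simp
  also have "\<dots> \<le> r ^ Suc v" using assms by (simp only: power_Suc) (rule mult_le_mono1, simp)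
  finally have "set_digit r a (Suc v) w < Suc (a div r ^ Suc v) * r ^ Suc v"
    by (simp add: set_digit_expand)
  also have "\<dots> \<le> r ^ e * r ^ Suc v"
    using \<open>a div r ^ Suc v < r ^ e\<close> by (intro mult_le_mono1) simp
  finally show ?thesis by (simp add: m power_add mult_ac)
qed

section \<open>Solving the coupled Vandermonde systems\<close>

text \<open>The coefficients of a polynomial of degree below \<open>r\<close> combine the equations
  into one whose weights are its values at the points \<open>x q\<close>. Choosing it to vanish at
  every point except \<open>x p\<close> isolates \<open>y p\<close>.\<close>

lemma vandermonde_zero:
  fixes x y :: "'i \<Rightarrow> 'a::field"
  assumes "finite P" "card P \<le> r" "inj_on x P"
    and sums: "\<And>t. t < r \<Longrightarrow> (\<Sum>p\<in>P. x p ^ t * y p) = 0"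
    and "p \<in> P"
  shows "y p = 0"
proof -
  define f where "f = (\<Prod>q\<in>P - {p}. [:- x q, 1:])"
  have "degree f \<le> (\<Sum>q\<in>P - {p}. 1)"
    unfolding f_def using degree_prod_sum_le[of "P - {p}" "\<lambda>q. [:- x q, 1:]"] assms(1) by simp
  also have "\<dots> < r" using assms(1,2,5) card_Diff1_less[of P p] by simp
  finally have deg: "degree f < r" .
  have "(\<Sum>q\<in>P. poly f (x q) * y q) = (\<Sum>q\<in>P. \<Sum>t\<le>degree f. coeff f t * (x q ^ t * y q))"
    by (simp add: poly_altdef sum_distrib_right mult.assoc)
  also have "\<dots> = (\<Sum>t\<le>degree f. coeff f t * (\<Sum>q\<in>P. x q ^ t * y q))"
    by (subst sum.swap) (simp add: sum_distrib_left)
  also have "\<dots> = 0" using deg sums by (intro sum.neutral) auto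
  finally have "(\<Sum>q\<in>P. poly f (x q) * y q) = 0" .
  moreover have "poly f (x q) * y q = 0" if "q \<in> P - {p}" for q
    using that assms(1) by (auto simp: f_def poly_prod prod_zero_iff)
  ultimately have "poly f (x p) * y p = 0"
    using assms(1,5) by (simp add: sum.remove)
  moreover have "poly f (x p) \<noteq> 0"
    using assms(1,3,5) by (auto simp: f_def poly_prod prod_zero_iff inj_on_def)
  ultimately show ?thesis by simp
qed

text \<open>
  Here \<open>v\<close> and \<open>u\<close> count from 0, \<open>x v w\<close> is \<open>\<lambda>\<close> at node \<open>(v, w)\<close>, and \<open>c v u b\<close> is coordinate \<open>b\<close> of node
  \<open>(v, u)\<close>. For \<open>w = a\<^sub>v\<close> the last summand of \<open>y\<close> is already \<open>c v w a\<close>, so the first one is 0.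
\<close>

lemma coupled_rows_zero:
  fixes x :: "nat \<Rightarrow> nat \<Rightarrow> 'a::field" and c :: "nat \<Rightarrow> nat \<Rightarrow> nat \<Rightarrow> 'a" and \<gamma> :: 'a and r :: nat
  defines "y \<equiv> \<lambda>a v w.
    (if digit r a (Suc v) = w then 0
     else (if digit r a (Suc v) < w then 1 else \<gamma>) * c v w a)
    + c v (digit r a (Suc v)) (set_digit r a (Suc v) w)"
  assumes T: "T \<subseteq> {..m} \<times> {..<r}" "card T \<le> r"
    and inj: "inj_on (\<lambda>(v, w). x v w) ({..m} \<times> {..<r})"
    and gam: "\<gamma> \<noteq> 0" "\<gamma> \<noteq> 1"
    and zero: "\<And>v u b. (v, u) \<notin> T \<Longrightarrow> c v u b = 0"
    and rows: "\<And>a t. a < r ^ Suc m \<Longrightarrow> t < r \<Longrightarrow>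
      (\<Sum>v\<le>m. \<Sum>w<r. x v w ^ t * y a v w) = 0"
  shows "a < r ^ Suc m \<Longrightarrow> c v u a = 0"
proof (induction "card {v. (v, digit r a (Suc v)) \<in> T}" arbitrary: a v u rule: less_induct)
  case less
  define B where "B a = {v. (v, digit r a (Suc v)) \<in> T}" for a
  have fT: "finite T" using T(1) finite_subset by blast
  have fB: "finite (B a)" for a
    by (rule finite_subset[of _ "fst ` T"]) (use fT in \<open>force simp: B_def\<close>)+
  \<comment> \<open>Stated for every row \<open>b\<close> with as many digits in \<open>T\<close> as
    \<open>a\<close>, because the partner row \<open>a(v,u)\<close> is needed below as well.\<close>
  have y_zero: "y b v w = 0" if b: "b < r ^ Suc m" "card (B b) = card (B a)" and vw: "(v, w) \<in> T" for b v w
  proof -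
    have off: "y b v w = 0" if "(v, w) \<in> {..m} \<times> {..<r} - T" for v w
    proof (cases "(v, digit r b (Suc v)) \<in> T")
      case True
      let ?b = "set_digit r b (Suc v) w"
      have w: "w < r" "v \<le> m" using that by auto
      have "v \<in> B b" using True by (simp add: B_def)
      \<comment> \<open>Since \<open>(v, w)\<close> is outside \<open>T\<close>, position
        \<open>v\<close> leaves the set and no other position changes, so the induction hypothesis
        covers \<open>?b\<close>.\<close>
      moreover have "B ?b = B b - {v}"
      proof (intro Set.set_eqI)
        fix v' show "v' \<in> B ?b \<longleftrightarrow> v' \<in> B b - {v}"
          using that w digit_set_digit_same[of w r b v] digit_set_digit_other[of w r v v' b]
          by (cases "v' = v") (auto simp: B_def)
      qed
      ultimately have "card (B ?b) < card (B b)"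
        using card_Diff1_less[OF fB] by metis
      then have "c v (digit r b (Suc v)) ?b = 0"
        using less.hyps[of ?b] set_digit_less[of b r m w v] b w by (simp add: B_def)
      then show ?thesis using that by (simp add: y_def zero)
    next
      case False
      then show ?thesis using that by (simp add: y_def zero)
    qed
    have "(\<Sum>p\<in>T. (case p of (v, w) \<Rightarrow> x v w) ^ t * (case p of (v, w) \<Rightarrow> y b v w)) = 0"
      if "t < r" for t
    proof -
      have "(\<Sum>p\<in>T. (case p of (v, w) \<Rightarrow> x v w) ^ t * (case p of (v, w) \<Rightarrow> y b v w)) =
        (\<Sum>p\<in>{..m} \<times> {..<r}. (case p of (v, w) \<Rightarrow> x v w) ^ t * (case p of (v, w) \<Rightarrow> y b v w))"
        using T(1) off by (intro sum.mono_neutral_left) auto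
      also have "\<dots> = 0"
        using rows[OF b(1) that] by (simp add: sum.cartesian_product split_def)
      finally show ?thesis .
    qed
    then show ?thesis
      using vandermonde_zero[OF fT T(2), of "\<lambda>(v, w). x v w" "\<lambda>(v, w). y b v w" "(v, w)"]
        inj_on_subset[OF inj T(1)] vw by simp
  qed
  show ?case
  proof (cases "(v, u) \<in> T")
    case False
    then show ?thesis by (rule zero)
  next
    case True
    then have u: "u < r" "v \<le> m" using T(1) by auto
    let ?d = "digit r a (Suc v)"
    note eq = y_zero[OF less.prems refl True]
    show ?thesis
    proof (cases "u = ?d")
      case True
      then show ?thesis using eq by (simp add: y_def set_digit_digit)
    next
      case ne: False
      show ?thesis
      proof (cases "(v, ?d) \<in> T")
        case False
        \<comment> \<open>The node \<open>(v, ?d)\<close> vanishes, so \<open>y\<close> reduces to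
          \<open>c v u a\<close> times 1 or \<gamma>, both nonzero.\<close>
        then show ?thesis using eq ne gam by (simp add: y_def zero split: if_splits)
      next
        case d: True
        let ?b = "set_digit r a (Suc v) u"
        have dig: "digit r ?b (Suc v) = u" using u by (rule_tac digit_set_digit_same)
        have "set_digit r ?b (Suc v) ?d = a"
          by (simp add: set_digit_set_digit[OF u(1)] set_digit_digit)
        \<comment> \<open>The old and the new digit at \<open>v\<close> both give nodes in
          \<open>T\<close>.\<close>
        moreover have "B ?b = B a"
        proof (intro Set.set_eqI)
          fix v' show "v' \<in> B ?b \<longleftrightarrow> v' \<in> B a"
            using d True dig digit_set_digit_other[OF u(1), of v v' a]
            by (cases "v' = v") (auto simp: B_def)
        qed
        then have "y ?b v ?d = 0"
          using set_digit_less[OF less.prems u] d by (intro y_zero) auto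
        \<comment> \<open>Rows \<open>a\<close> and \<open>?b\<close> carry the same two unknowns,
          \<open>c v u a\<close> and \<open>c v ?d ?b\<close>. One row is their sum; the other has
          \<gamma> in front of exactly one of them.\<close>
        ultimately show ?thesis
          using eq ne gam dig
          by (auto simp: y_def add_eq_0_iff2 algebra_simps split: if_splits)
      qed
    qed
  qed
qed


section \<open>Parity checks and the syndrome map\<close>

text \<open>A row with digit \<open>u\<close> at \<open>v\<close> is supported within the
  \<open>r\<close> distinct indices \<open>a(v,w)\<close>; every other row has only its diagonal
  entry. Here \<open>v\<close> counts from 0, so node \<open>(v, u)\<close> has number
  \<open>v * r + u + 1\<close>.\<close>

lemma parity_block_mult_index:
  fixes lam :: "nat \<Rightarrow> 'a::field" and x :: "'a vec" and r m :: nat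
  assumes "a < r ^ Suc m" "u < r" "v \<le> m" "x \<in> carrier_vec (r ^ Suc m)"
  shows "(parity_block r m lam \<gamma> t (v * r + u + 1) *\<^sub>v x) $ a =
    (if digit r a (Suc v) = u
     then \<Sum>w<r. lam (v * r + w + 1) ^ t * x $ set_digit r a (Suc v) w
     else (if digit r a (Suc v) < u then 1 else \<gamma>) * lam (v * r + u + 1) ^ t * x $ a)"
proof -
  let ?d = "digit r a (Suc v)" and ?l = "r ^ Suc m"
  have vu: "(v * r + u + 1 - 1) div r = v" "(v * r + u + 1 - 1) mod r = u"
    using assms(2) by auto
  define A where "A b = (if ?d < u \<and> b = a then lam (v * r + u + 1) ^ t
        else if ?d > u \<and> b = a then \<gamma> * lam (v * r + u + 1) ^ t
        else if ?d = u \<and> (\<exists>w < r. b = set_digit r a (Suc v) w)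
          then lam (v * r + digit r b (Suc v) + 1) ^ t
        else 0)" for b
  have block: "Matrix.row (parity_block r m lam \<gamma> t (v * r + u + 1)) a = vec ?l A"
    using assms(1) unfolding parity_block_def Let_def vu
    by (intro eq_vecI) (auto simp: A_def)
  have row: "(parity_block r m lam \<gamma> t (v * r + u + 1) *\<^sub>v x) $ a = (\<Sum>b<?l. A b * x $ b)"
    using assms(1,4) block
    by (simp add: scalar_prod_def atLeast0LessThan parity_block_def Let_def del: power_Suc)
  show ?thesis
  proof (cases "?d = u")
    case False
    then have "(\<Sum>b<?l. A b * x $ b) =
      (\<Sum>b<?l. if b = a then (if ?d < u then 1 else \<gamma>) * lam (v * r + u + 1) ^ t * x $ a else 0)"
      by (intro sum.cong) (auto simp: A_def)
    then show ?thesis using False assms(1) row by (simp del: power_Suc)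
  next
    case True
    let ?S = "set_digit r a (Suc v) ` {..<r}"
    have "(\<Sum>b<?l. A b * x $ b) = (\<Sum>b\<in>?S. A b * x $ b)"
    proof (rule sum.mono_neutral_right)
      show "?S \<subseteq> {..<?l}" using assms set_digit_less by (auto simp del: power_Suc)
    qed (use True in \<open>auto simp: A_def\<close>)
    also have "\<dots> = (\<Sum>w<r. A (set_digit r a (Suc v) w) * x $ set_digit r a (Suc v) w)"
      by (rule sum.reindex[unfolded comp_def], rule inj_on_inverseI[where g = "\<lambda>b. digit r b (Suc v)"])
        (simp add: digit_set_digit_same)
    also have "\<dots> = (\<Sum>w<r. lam (v * r + w + 1) ^ t * x $ set_digit r a (Suc v) w)"
      using True by (intro sum.cong) (auto simp: A_def digit_set_digit_same)
    finally show ?thesis using True row by simp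
  qed
qed

lemma sum_groups:
  fixes f :: "nat \<Rightarrow> 'a::comm_monoid_add"
  shows "(\<Sum>v\<le>m. \<Sum>u<r. f (v * r + u)) = sum f {..<r * Suc m}"
proof -
  have "sum f {v * r..<v * r + r} = (\<Sum>u<r. f (v * r + u))" for v
    using sum.shift_bounds_nat_ivl[of f 0 "v * r" r] by (simp add: add.commute atLeast0LessThan)
  then show ?thesis
    using sum.nat_group[of f r "Suc m"] by (simp add: lessThan_Suc_atMost mult.commute)
qed

text \<open>Column \<open>t\<close> is the left-hand side of check \<open>t\<close>. Collecting all
  checks in one matrix makes the code the kernel of a single linear map between matrix
  spaces.\<close>

definition parity_syndrome ::
  "nat \<Rightarrow> nat \<Rightarrow> nat \<Rightarrow> (nat \<Rightarrow> 'a::field) \<Rightarrow> 'a \<Rightarrow> 'a mat \<Rightarrow> 'a mat" where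
  "parity_syndrome r m n lam \<gamma> C = mat (r ^ Suc m) r
     (\<lambda>(a, t). \<Sum>i\<in>{1..n}. (parity_block r m lam \<gamma> t i *\<^sub>v node C i) $ a)"

lemma parity_syndrome_carrier: "parity_syndrome r m n lam \<gamma> C \<in> carrier_mat (r ^ Suc m) r"
  by (simp add: parity_syndrome_def)

lemma parity_block_carrier: "parity_block r m lam \<gamma> t i \<in> carrier_mat (r ^ Suc m) (r ^ Suc m)"
  by (simp add: parity_block_def Let_def)

lemma node_carrier: "C \<in> carrier_mat l n \<Longrightarrow> node C i \<in> carrier_vec l"
  by (auto simp: node_def)

lemma parity_code_iff:
  "C \<in> parity_code r m n lam \<gamma> \<longleftrightarrow>
     C \<in> carrier_mat (r ^ Suc m) n \<and> parity_syndrome r m n lam \<gamma> C = 0\<^sub>m (r ^ Suc m) r"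
proof (cases "C \<in> carrier_mat (r ^ Suc m) n")
  case True
  let ?l = "r ^ Suc m"
  let ?f = "\<lambda>t i. parity_block r m lam \<gamma> t i *\<^sub>v node C i"
  have f: "?f t \<in> {1..n} \<rightarrow> carrier_vec ?l" for t
    by (intro funcsetI mult_mat_vec_carrier[OF parity_block_carrier] node_carrier[OF True])
  have dim: "finsum_vec TYPE('a) ?l (?f t) {1..n} \<in> carrier_vec ?l" for t
    using f by (rule finsum_vec_closed)
  have "finsum_vec TYPE('a) ?l (?f t) {1..n} = 0\<^sub>v ?l \<longleftrightarrow>
      (\<forall>a<?l. (\<Sum>i\<in>{1..n}. ?f t i $ a) = 0)" for t
    using dim[of t] index_finsum_vec[OF _ _ f]
    by (auto simp: vec_eq_iff simp del: power_Suc index_mult_mat_vec)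
  then show ?thesis using True
    by (auto simp: parity_code_def parity_syndrome_def mat_eq_iff
        simp del: power_Suc index_mult_mat_vec)
next
  case False
  then show ?thesis by (simp add: parity_code_def)
qed

lemma parity_syndrome_add:
  assumes "C \<in> carrier_mat (r ^ Suc m) n" "D \<in> carrier_mat (r ^ Suc m) n"
  shows "parity_syndrome r m n lam \<gamma> (C + D) =
    parity_syndrome r m n lam \<gamma> C + parity_syndrome r m n lam \<gamma> D"
proof -
  have "(parity_block r m lam \<gamma> t i *\<^sub>v node (C + D) i) $ a =
      (parity_block r m lam \<gamma> t i *\<^sub>v node C i) $ a + (parity_block r m lam \<gamma> t i *\<^sub>v node D i) $ a"
    if "i \<in> {1..n}" "a < r ^ Suc m" for t i a
  proof -
    have "node (C + D) i = node C i + node D i"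
      using assms that by (auto simp: node_def)
    then show ?thesis
      using that(2) mult_add_distrib_mat_vec[OF parity_block_carrier[of r m lam \<gamma> t i]
          node_carrier[OF assms(1), of i] node_carrier[OF assms(2), of i]] parity_block_carrier[of r m lam \<gamma> t i]
      by (auto simp del: power_Suc index_mult_mat_vec simp: mult_mat_vec_def)
  qed
  then show ?thesis
    by (intro eq_matI)
      (auto simp: parity_syndrome_def sum.distrib simp del: power_Suc index_mult_mat_vec)
qed

lemma parity_syndrome_smult:
  assumes "C \<in> carrier_mat (r ^ Suc m) n"
  shows "parity_syndrome r m n lam \<gamma> (k \<cdot>\<^sub>m C) = k \<cdot>\<^sub>m parity_syndrome r m n lam \<gamma> C"
proof -
  have "(parity_block r m lam \<gamma> t i *\<^sub>v node (k \<cdot>\<^sub>m C) i) $ a =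
      k * (parity_block r m lam \<gamma> t i *\<^sub>v node C i) $ a"
    if "i \<in> {1..n}" "a < r ^ Suc m" for t i a
  proof -
    have "node (k \<cdot>\<^sub>m C) i = k \<cdot>\<^sub>v node C i"
      using assms that by (auto simp: node_def)
    then show ?thesis
      using that(2) mult_mat_vec[OF parity_block_carrier[of r m lam \<gamma> t i] node_carrier[OF assms, of i], of k]
        parity_block_carrier[of r m lam \<gamma> t i]
      by (auto simp del: power_Suc index_mult_mat_vec simp: mult_mat_vec_def)
  qed
  then show ?thesis
    by (intro eq_matI)
      (auto simp: parity_syndrome_def sum_distrib_left simp del: power_Suc index_mult_mat_vec)
qed

text \<open>Transfers \<open>coupled_rows_zero\<close> to matrices. The set \<open>T\<close>
  consists of column numbers, counted from 0.\<close>

lemma parity_syndrome_zero_imp: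
  fixes lam :: "nat \<Rightarrow> 'a::field"
  assumes n: "n \<le> r * Suc m" and inj: "inj_on lam {1..r * Suc m}"
    and gam: "\<gamma> \<noteq> 0" "\<gamma> \<noteq> 1"
    and C: "C \<in> carrier_mat (r ^ Suc m) n"
    and synd: "parity_syndrome r m n lam \<gamma> C = 0\<^sub>m (r ^ Suc m) r"
    and T: "finite T" "card T \<le> r"
    and off: "\<And>b j. b < r ^ Suc m \<Longrightarrow> j < n \<Longrightarrow> j \<notin> T \<Longrightarrow> C $$ (b, j) = 0"
  shows "C = 0\<^sub>m (r ^ Suc m) n"
proof -
  let ?l = "r ^ Suc m"
  \<comment> \<open>Zero padding completes the word to \<open>r * Suc m\<close> nodes, so that all
    groups have full size \<open>r\<close>.\<close>
  define c where "c v u b = (if b < ?l \<and> v \<le> m \<and> u < r \<and> v * r + u < n then C $$ (b, v * r + u) else 0)" for v u b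
  define P where "P = {(v, u) \<in> {..m} \<times> {..<r}. v * r + u < n \<and> v * r + u \<in> T}"
  have idx: "v * r + u < r * Suc m" if "v \<le> m" "u < r" for v u
  proof -
    have "v * r + u < Suc v * r" using that by simp
    also have "\<dots> \<le> Suc m * r" using that by (intro mult_le_mono1) simp
    finally show ?thesis by (simp add: mult.commute)
  qed
  have inj_idx: "inj_on (\<lambda>(v, u). v * r + u) ({..m} \<times> {..<r})"
    by (rule inj_on_inverseI[where g = "\<lambda>q. (q div r, q mod r)"]) auto
  have P: "P \<subseteq> {..m} \<times> {..<r}" by (auto simp: P_def)
  have "card P = card ((\<lambda>(v, u). v * r + u) ` P)"
    by (rule card_image[symmetric], rule inj_on_subset[OF inj_idx P])
  also have "\<dots> \<le> card T" by (rule card_mono[OF T(1)]) (auto simp: P_def)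
  finally have cardP: "card P \<le> r" using T(2) by simp
  have injx: "inj_on (\<lambda>(v, w). lam (v * r + w + 1)) ({..m} \<times> {..<r})"
  proof -
    have "inj_on (\<lambda>q. lam (q + 1)) {..<r * Suc m}"
    proof (rule inj_onI)
      fix p q assume "p \<in> {..<r * Suc m}" "q \<in> {..<r * Suc m}" "lam (p + 1) = lam (q + 1)"
      then have "p + 1 = q + 1" by (intro inj_onD[OF inj]) auto
      then show "p = q" by simp
    qed
    then have "inj_on (\<lambda>q. lam (q + 1)) ((\<lambda>(v, u). v * r + u) ` ({..m} \<times> {..<r}))"
      by (rule inj_on_subset) (auto simp: idx simp del: mult_Suc_right)
    from comp_inj_on[OF inj_idx this] show ?thesis by (simp add: comp_def split_def)
  qed
  have zero: "c v u b = 0" if "(v, u) \<notin> P" for v u b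
    using that off by (auto simp: c_def P_def)
  have rows: "(\<Sum>v\<le>m. \<Sum>w<r. lam (v * r + w + 1) ^ t *
      ((if digit r a (Suc v) = w then 0
        else (if digit r a (Suc v) < w then 1 else \<gamma>) * c v w a)
       + c v (digit r a (Suc v)) (set_digit r a (Suc v) w))) = 0"
    if a: "a < ?l" and t: "t < r" for a t
  proof -
    \<comment> \<open>\<open>G v u\<close> is the contribution of node \<open>(v, u)\<close> to row
      \<open>a\<close>. Regrouping by \<lambda> moves each term of the node with
      \<open>u = digit r a (Suc v)\<close> to the position \<open>w\<close> whose \<lambda> it
      carries.\<close>
    define G where "G v u = (if digit r a (Suc v) = u
      then \<Sum>w<r. lam (v * r + w + 1) ^ t * c v u (set_digit r a (Suc v) w)
      else (if digit r a (Suc v) < u then 1 else \<gamma>) * lam (v * r + u + 1) ^ t * c v u a)" for v u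
    have r0: "0 < r" using t by simp
    have G: "G v u = (if v * r + u < n
        then (parity_block r m lam \<gamma> t (v * r + u + 1) *\<^sub>v node C (v * r + u + 1)) $ a else 0)"
      if "v \<le> m" "u < r" for v u
      using parity_block_mult_index[OF a that(2,1) node_carrier[OF C], of lam \<gamma> t "v * r + u + 1"]
        set_digit_less[OF a _ that(1)] a C that
      by (auto simp: G_def c_def node_def simp del: power_Suc index_mult_mat_vec intro!: sum.cong)
    have "(\<Sum>v\<le>m. \<Sum>w<r. lam (v * r + w + 1) ^ t *
      ((if digit r a (Suc v) = w then 0
        else (if digit r a (Suc v) < w then 1 else \<gamma>) * c v w a)
       + c v (digit r a (Suc v)) (set_digit r a (Suc v) w))) = (\<Sum>v\<le>m. \<Sum>u<r. G v u)"
    proof (rule sum.cong[OF refl])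
      fix v
      let ?d = "digit r a (Suc v)"
      have d: "?d \<in> {..<r}" using r0 by (simp add: digit_less)
      have "(\<Sum>u<r. G v u) = (\<Sum>w<r. lam (v * r + w + 1) ^ t * c v ?d (set_digit r a (Suc v) w)) +
         (\<Sum>w\<in>{..<r} - {?d}. lam (v * r + w + 1) ^ t * ((if ?d < w then 1 else \<gamma>) * c v w a))"
        by (subst sum.remove[OF _ d]) (auto simp: G_def intro!: sum.cong)
      \<comment> \<open>The omitted index \<open>?d\<close> returns as a zero term.\<close>
      also have "(\<Sum>w\<in>{..<r} - {?d}. lam (v * r + w + 1) ^ t * ((if ?d < w then 1 else \<gamma>) * c v w a)) =
        (\<Sum>w<r. lam (v * r + w + 1) ^ t * (if ?d = w then 0 else (if ?d < w then 1 else \<gamma>) * c v w a))"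
        by (rule sum.mono_neutral_cong_left) auto
      finally show "(\<Sum>w<r. lam (v * r + w + 1) ^ t *
        ((if ?d = w then 0 else (if ?d < w then 1 else \<gamma>) * c v w a)
         + c v ?d (set_digit r a (Suc v) w))) = (\<Sum>u<r. G v u)"
        by (simp only: distrib_left sum.distrib add.commute)
    qed
    also have "\<dots> = (\<Sum>q<r * Suc m. if q < n
        then (parity_block r m lam \<gamma> t (q + 1) *\<^sub>v node C (q + 1)) $ a else 0)"
      unfolding sum_groups[symmetric] using G by (intro sum.cong refl) (simp del: index_mult_mat_vec)
    also have "\<dots> = (\<Sum>q<n. (parity_block r m lam \<gamma> t (q + 1) *\<^sub>v node C (q + 1)) $ a)"
      using n by (intro sum.mono_neutral_cong_right) (auto simp del: index_mult_mat_vec)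
    also have "\<dots> = (\<Sum>i\<in>{1..n}. (parity_block r m lam \<gamma> t i *\<^sub>v node C i) $ a)"
      by (rule sum.reindex_bij_witness[of _ "\<lambda>i. i - 1" "\<lambda>q. q + 1"]) auto
    also have "\<dots> = parity_syndrome r m n lam \<gamma> C $$ (a, t)"
      using a t by (simp add: parity_syndrome_def del: index_mult_mat_vec power_Suc)
    also have "\<dots> = 0" using a t by (simp add: synd del: power_Suc)
    finally show ?thesis .
  qed
  show ?thesis
  proof (rule eq_matI)
    fix b j assume bj: "b < dim_row (0\<^sub>m ?l n)" "j < dim_col (0\<^sub>m ?l n)"
    then have j: "j < n" and b: "b < ?l" by auto
    then have "j < Suc m * r" using n by (simp add: mult.commute)
    then have "j div r \<le> m" "j mod r < r"
      by (auto simp: less_Suc_eq_le[symmetric] intro: less_mult_imp_div_less intro!: mod_less_divisor Nat.gr0I)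
    moreover have "c (j div r) (j mod r) b = 0"
      using b by (intro coupled_rows_zero[OF P cardP injx gam zero rows])
    ultimately show "C $$ (b, j) = 0\<^sub>m ?l n $$ (b, j)"
      using j b by (simp add: c_def del: power_Suc)
  qed (use C in auto)
qed

section \<open>Dimension of matrix spaces and surjectivity of the syndrome\<close>

lemma finite_carrier_mat: "finite (carrier_mat nr nc :: 'a::finite mat set)"
proof (rule finite_subset)
  show "(carrier_mat nr nc :: 'a mat set) \<subseteq> mat nr nc ` (({..<nr} \<times> {..<nc}) \<rightarrow>\<^sub>E UNIV)"
  proof
    fix A :: "'a mat"
    assume "A \<in> carrier_mat nr nc"
    then have "A = mat nr nc (restrict (($$) A) ({..<nr} \<times> {..<nc}))"
      by (intro eq_matI) auto
    then show "A \<in> mat nr nc ` (({..<nr} \<times> {..<nc}) \<rightarrow>\<^sub>E UNIV)"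
      by (rule image_eqI[where f = "mat nr nc"]) auto
  qed
qed (intro finite_imageI finite_PiE; simp)

lemma linear_mapI:
  assumes "vectorspace K V" "vectorspace K W" "f \<in> LinearCombinations.module_hom K V W"
  shows "linear_map K V W f"
  using assms by (simp add: linear_map_def mod_hom_def mod_hom_axioms_def vectorspace_def)

text \<open>Stacking columns identifies matrices with vectors of length \<open>nr * nc\<close>,
  whose dimension is known. The map \<open>f\<close> undoes the stacking.\<close>

lemma module_mat_dim:
  shows "vectorspace.fin_dim class_ring (module_mat TYPE('a::field) nr nc)"
    and "vectorspace.dim class_ring (module_mat TYPE('a::field) nr nc) = nr * nc"
proof -
  let ?V = "module_vec TYPE('a) (nr * nc)" and ?W = "module_mat TYPE('a) nr nc"
  define f where "f v = mat nr nc (\<lambda>(i, j). v $ (j * nr + i))" for v :: "'a vec"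
  have idx: "j * nr + i < nr * nc" if "i < nr" "j < nc" for i j
  proof -
    have "j * nr + i < Suc j * nr" using that by simp
    also have "\<dots> \<le> nc * nr" using that by (intro mult_le_mono1) simp
    finally show ?thesis by (simp add: mult.commute)
  qed
  interpret vec: vec_space "TYPE('a)" "nr * nc" .
  interpret f: linear_map class_ring ?V ?W f
    by (rule linear_mapI[OF vec_vs matrix_vs])
      (auto simp: LinearCombinations.module_hom_def module_vec_simps module_mat_simps f_def idx intro!: eq_matI)
  have inj: "inj_on f (carrier ?V)"
  proof (rule inj_onI)
    fix v w assume v: "v \<in> carrier ?V" and w: "w \<in> carrier ?V" and eq: "f v = f w"
    show "v = w"
    proof (rule eq_vecI)
      fix q assume "q < dim_vec w"
      then have q: "q < nc * nr" using w by (simp add: module_vec_simps mult.commute)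
      then have "q div nr < nc" "q mod nr < nr"
        by (auto intro: less_mult_imp_div_less intro!: mod_less_divisor Nat.gr0I)
      moreover have "f v $$ (q mod nr, q div nr) = f w $$ (q mod nr, q div nr)" using eq by simp
      ultimately show "v $ q = w $ q" by (simp add: f_def)
    qed (use v w in \<open>simp add: module_vec_simps\<close>)
  qed
  have surj: "f ` carrier ?V = carrier ?W"
  proof
    show "carrier ?W \<subseteq> f ` carrier ?V"
    proof
      fix A :: "'a mat" assume A: "A \<in> carrier ?W"
      then have "A = f (vec (nr * nc) (\<lambda>q. A $$ (q mod nr, q div nr)))"
        by (intro eq_matI) (auto simp: f_def module_mat_simps idx)
      then show "A \<in> f ` carrier ?V" by (rule image_eqI) (simp add: module_vec_simps)
    qed
  qed (auto simp: f_def module_mat_simps)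
  show "vectorspace.fin_dim class_ring ?W"
    using vec.fin_dim surj by (rule f.surj_fin_dim)
  show "vectorspace.dim class_ring ?W = nr * nc"
    using f.dim_eq[OF vec.fin_dim inj surj] vec.dim_is_n by simp
qed

lemma parity_syndrome_linear:
  "linear_map class_ring (module_mat TYPE('a::field) (r ^ Suc m) n) (module_mat TYPE('a) (r ^ Suc m) r)
     (parity_syndrome r m n lam \<gamma>)"
  using parity_syndrome_carrier[of r m n lam \<gamma>]
  by (intro linear_mapI[OF matrix_vs matrix_vs])
    (auto simp: LinearCombinations.module_hom_def module_mat_simps parity_syndrome_add
      parity_syndrome_smult)

text \<open>Words supported on the first \<open>r\<close> columns form a copy of the target space,
  and they already reach all of it.\<close>

lemma parity_syndrome_surj:
  fixes lam :: "nat \<Rightarrow> 'a::{field, finite}"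
  assumes "r \<le> n" "n \<le> r * Suc m" "inj_on lam {1..r * Suc m}" "\<gamma> \<noteq> 0" "\<gamma> \<noteq> 1"
  shows "parity_syndrome r m n lam \<gamma> ` carrier_mat (r ^ Suc m) n = carrier_mat (r ^ Suc m) r"
proof -
  let ?l = "r ^ Suc m"
  let ?S = "parity_syndrome r m n lam \<gamma>"
  \<comment> \<open>\<open>E\<close> appends zero columns; \<open>r \<le> n\<close> ensures that no
    column of \<open>X\<close> is lost.\<close>
  define E :: "'a mat \<Rightarrow> 'a mat"
    where "E X = mat ?l n (\<lambda>(b, j). if j < r then X $$ (b, j) else 0)" for X
  have E: "E X \<in> carrier_mat ?l n" for X by (simp add: E_def)
  have "inj_on (?S \<circ> E) (carrier_mat ?l r)"
  proof (rule inj_onI)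
    fix X Y assume X: "X \<in> carrier_mat ?l r" and Y: "Y \<in> carrier_mat ?l r"
      and eq: "(?S \<circ> E) X = (?S \<circ> E) Y"
    define Z where "Z = E X + (- 1) \<cdot>\<^sub>m E Y"
    have Z: "Z \<in> carrier_mat ?l n" using E by (simp add: Z_def)
    have "?S Z = ?S (E X) + (- 1) \<cdot>\<^sub>m ?S (E Y)"
      unfolding Z_def using E by (simp add: parity_syndrome_add parity_syndrome_smult del: power_Suc)
    also have "\<dots> = 0\<^sub>m ?l r"
      using eq parity_syndrome_carrier[of r m n lam \<gamma> "E Y"] by (intro eq_matI) auto
    finally have "Z = 0\<^sub>m ?l n"
      using assms E by (intro parity_syndrome_zero_imp[OF assms(2-5) Z, of "{..<r}"])
        (auto simp: Z_def E_def simp del: power_Suc)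
    then have "Z $$ (b, j) = 0" if "b < ?l" "j < r" for b j
      using that assms(1) by simp
    then show "X = Y"
      using X Y assms(1) by (intro eq_matI) (auto simp: Z_def E_def simp del: power_Suc)
  qed
  moreover have "(?S \<circ> E) ` carrier_mat ?l r \<subseteq> carrier_mat ?l r"
    using parity_syndrome_carrier by auto
  ultimately have "(?S \<circ> E) ` carrier_mat ?l r = carrier_mat ?l r"
    using finite_carrier_mat by (intro endo_inj_surj)
  moreover have "(?S \<circ> E) ` carrier_mat ?l r \<subseteq> ?S ` carrier_mat ?l n"
    unfolding image_comp[symmetric] using E by (intro image_mono image_subsetI)
  moreover have "?S ` carrier_mat ?l n \<subseteq> carrier_mat ?l r"
    by (intro image_subsetI parity_syndrome_carrier)
  ultimately show ?thesis by (intro equalityI) simp_all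
qed

section \<open>Dimension and recovery property of the code\<close>

theorem corollary4:
  fixes r m r' n k l :: nat
    and lam :: "nat \<Rightarrow> 'a::{field, finite}"
    and \<gamma> :: 'a
  assumes "m \<ge> 1"
    and "1 \<le> r'" and "r' \<le> r - 1"
    and "n = r * m + r'" and "k = n - r" and "l = r ^ (m + 1)"
    and "card (UNIV :: 'a set) \<ge> r * (m + 1)"
    and "inj_on lam {1..r * (m + 1)}"
    and "\<gamma> \<notin> {0, 1}"
  shows "mds_array_code n k l (parity_code r m n lam \<gamma>)"
proof -
  let ?\<C> = "parity_code r m n lam \<gamma>"
  let ?S = "parity_syndrome r m n lam \<gamma>"
  have l: "l = r ^ Suc m" using assms(6) by simp
  \<comment> \<open>From \<open>m \<ge> 1\<close> comes \<open>r \<le> n\<close>, so the subtraction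
    in \<open>k = n - r\<close> is exact.\<close>
  have "r * 1 \<le> r * m" using assms(1) by (intro mult_le_mono2)
  then have rn: "r \<le> n" unfolding assms(4) by linarith
  have n: "n \<le> r * Suc m" using assms(3,4) by simp
  have inj: "inj_on lam {1..r * Suc m}" using assms(8) by simp
  have gam: "\<gamma> \<noteq> 0" "\<gamma> \<noteq> 1" using assms(9) by auto
  interpret S: linear_map class_ring "module_mat TYPE('a) l n" "module_mat TYPE('a) l r" ?S
    unfolding l by (rule parity_syndrome_linear)
  have ker: "?\<C> = S.kerT"
    unfolding S.ker_def module_mat_simps
    by (rule Set.set_eqI) (simp only: parity_code_iff l mem_Collect_eq)
  have im: "S.imT = carrier (module_mat TYPE('a) l r)"
    using parity_syndrome_surj[OF rn n inj gam] unfolding S.im_def module_mat_simps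
    by (simp only: l)
  have sub: "subspace class_ring ?\<C> (module_mat TYPE('a) l n)"
    unfolding ker by (rule S.kerT_is_subspace)
  \<comment> \<open>Rank-nullity, with rank \<open>l * r\<close> by surjectivity.\<close>
  have "l * r + vectorspace.dim class_ring ((module_mat TYPE('a) l n)\<lparr>carrier := ?\<C>\<rparr>) = l * n"
    using S.rank_nullity_main(1)[OF module_mat_dim(1)]
    unfolding im ker by (simp add: module_mat_dim(2))
  then have dim: "vectorspace.dim class_ring ((module_mat TYPE('a) l n)\<lparr>carrier := ?\<C>\<rparr>) = k * l"
    unfolding assms(5) by (simp add: diff_mult_distrib2 mult.commute[of _ l])
  \<comment> \<open>The difference of the two words vanishes on \<open>N\<close>, hence lives on at
    most \<open>r\<close> nodes and is zero; the words agree everywhere.\<close>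
  have recover: "node C i = node D i"
    if N: "N \<subseteq> {1..n}" "card N = k" and C: "C \<in> ?\<C>" and D: "D \<in> ?\<C>"
      and eq: "\<forall>i\<in>N. node C i = node D i" for N C D i
  proof -
    define Z where "Z = C + (- 1) \<cdot>\<^sub>m D"
    have CD: "C \<in> carrier_mat l n" "D \<in> carrier_mat l n" "?S C = 0\<^sub>m l r" "?S D = 0\<^sub>m l r"
      using C D by (auto simp: parity_code_iff l simp del: power_Suc)
    have Z: "Z \<in> carrier_mat l n" using CD by (simp add: Z_def)
    have SZ: "?S Z = 0\<^sub>m l r"
      using CD unfolding Z_def l
      by (subst parity_syndrome_add) (auto simp: parity_syndrome_smult simp del: power_Suc)
    \<comment> \<open>Shifts node numbers, which start at 1, to column numbers, which start at
      0.\<close>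
    let ?T = "(\<lambda>i. i - 1) ` ({1..n} - N)"
    have "card ?T \<le> card ({1..n} - N)" by (rule card_image_le) simp
    also have "\<dots> = n - k" using N by (simp add: card_Diff_subset finite_subset)
    also have "\<dots> = r" using assms(5) rn by simp
    finally have T: "card ?T \<le> r" .
    have "Z $$ (b, j) = 0" if b: "b < l" and j: "j < n" "j \<notin> ?T" for b j
    proof -
      have "Suc j \<in> N" using j by (force simp: image_iff)
      then have "col C j = col D j" using eq by (auto simp: node_def)
      then have "col C j $ b = col D j $ b" by simp
      then show ?thesis using b j CD by (simp add: Z_def)
    qed
    then have "Z = 0\<^sub>m l n"
      using T Z SZ unfolding l by (intro parity_syndrome_zero_imp[OF n inj gam, of Z ?T]) auto
    moreover have "Z $$ (b, j) = C $$ (b, j) - D $$ (b, j)" if "b < l" "j < n" for b j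
      using that CD by (simp add: Z_def)
    ultimately have "C $$ (b, j) = D $$ (b, j)" if "b < l" "j < n" for b j
      using that by simp
    then have "C = D" using CD by (intro eq_matI) auto
    then show ?thesis by simp
  qed
  show ?thesis
    unfolding mds_array_code_def array_code_def using sub dim recover by blast
qed

end
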